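(* (i) For all $x,y\in\mathbb{B}^n$, $h_{\mathbb{B}^n}(x,y)\le 2\,j_{\mathbb{B}^n}(x,y)$. (ii) For all $x,y\in\mathbb{B}^n$ with $x\ne y$, the equality $h_{\mathbb{B}^n}(x,y)=2\,j_{\mathbb{B}^n}(x,y)$ holds if and only if $x=-y$ (while in the trivial case $x=y$ one has $h_{\mathbb{B}^n}(x,y)=j_{\mathbb{B}^n}(x,y)=0$). (iii) There is no $c\in\mathbb{R}$ such that $j_{\mathbb{B}^n}(x,y)\le c\,h_{\mathbb{B}^n}(x,y)$ for all $x,y\in\mathbb{B}^n$.
   Context: Let $n\ge 2$ and let $\mathbb{B}^n$ be the open Euclidean unit ball in $\mathbb{R}^n$, with boundary sphere $S^{n-1}$. For distinct $x,y\in\mathbb{R}^n$, $L(x,y)$ denotes the Euclidean line through $x$ and $y$. Hilbert metric: for distinct $x,y\in\mathbb{B}^n$, $$h_{\mathbb{B}^n}(x,y)=\log\frac{|u-y|\,|x-v|}{|u-x|\,|y-v|},$$ where $u,v$ are the two points of $L(x,y)\cap S^{n-1}$, ordered so that $|u-x|<|u-y|$; and $h_{\mathbb{B}^n}(x,x)=0$. The logarithm is natural. Distance ratio metric: for $x,y\in\mathbb{B}^n$, $$j_{\mathbb{B}^n}(x,y)=\log\left(1+\frac{|x-y|}{\min\{1-|x|,\,1-|y|\}}\right)$$ (here $1-|x|$ is the Euclidean distance from $x$ to the boundary of $\mathbb{B}^n$). *)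

theory Defs
  imports "HOL-Analysis.Analysis"
begin

text \<open>
  Only meaningful for distinct \<open>x\<close>, \<open>y\<close> in the open unit ball: then the line through them meets the
  unit sphere in exactly two points, and the ordering condition determines the pair uniquely.
\<close>

definition hilbert_ends :: "'a::euclidean_space \<Rightarrow> 'a \<Rightarrow> 'a \<times> 'a" where
  "hilbert_ends x y =
     (THE (u, v). u \<noteq> v \<and> affine hull {x, y} \<inter> sphere 0 1 = {u, v} \<and> dist u x < dist u y)"

definition hilbert_ball :: "'a::euclidean_space \<Rightarrow> 'a \<Rightarrow> real" where
  "hilbert_ball x y =
     (if x = y then 0
      else (let (u, v) = hilbert_ends x y
            in ln ((dist u y * dist x v) / (dist u x * dist y v))))"

definition dist_ratio_ball :: "'a::euclidean_space \<Rightarrow> 'a \<Rightarrow> real" where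
  "dist_ratio_ball x y = ln (1 + dist x y / min (1 - norm x) (1 - norm y))"

end

theory Submission
  imports Defs
begin

text \<open>
  Let the chord through \<open>x\<close> and \<open>y\<close> end in \<open>u = x + \<alpha> (x - y)\<close> and \<open>v = y + \<beta> (y - x)\<close> with
  \<open>\<alpha>, \<beta> > 0\<close>. The cross ratio then factorises, and the Hilbert distance is
  \<open>ln (1 + 1/\<alpha>) + ln (1 + 1/\<beta>)\<close> (\<open>hilbert_ball_eq_ln_add\<close>).
  Put \<open>d = |x - y|\<close>, and let \<open>m\<close> be the smaller of \<open>1 - |x|\<close> and \<open>1 - |y|\<close>. Since \<open>u\<close> lies on the unit
  sphere at distance \<open>\<alpha> d\<close> from \<open>x\<close>, the triangle inequality gives \<open>\<alpha> d \<ge> 1 - |x| \<ge> m\<close>; likewise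
  \<open>\<beta> d \<ge> m\<close>. So each of the two logarithms is at most \<open>ln (1 + d/m)\<close>, the distance ratio metric, and
  this is the factor 2.

  Equality forces \<open>\<alpha> d = 1 - |x| = m = 1 - |y| = \<beta> d\<close>. So \<open>x\<close> and \<open>y\<close> have
  the same norm, and the triangle inequalities are sharp, which means that the chord leaves the ball
  radially at both ends. It is therefore a diameter, and \<open>x = -y\<close>.

  For the failure of a converse bound, take a chord at distance \<open>s\<close> from the origin and the two points
  that cut it in the ratio \<open>1 : 2 : 1\<close>. Their Hilbert distance is always \<open>2 ln 3\<close>. As \<open>s\<close> tends to 1
  their separation is of the order \<open>sqrt (1 - s)\<close>, but their distance to the sphere is of the order
  \<open>1 - s\<close>, so the distance ratio metric is unbounded. Such chords need a second dimension.
\<close>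

section \<open>The Hilbert metric in terms of the chord\<close>

text \<open>
  The squared norm is a quadratic polynomial along a line, so it takes the value 1 at most twice.
\<close>

lemma norm_eq_1_on_line:
  fixes x w :: "'a::real_inner"
  assumes "w \<noteq> 0" "p \<noteq> q"
    and "norm (x + p *\<^sub>R w) = 1" "norm (x + q *\<^sub>R w) = 1" "norm (x + t *\<^sub>R w) = 1"
  shows "t = p \<or> t = q"
proof -
  have quadratic: "x \<bullet> x + 2 * r * (x \<bullet> w) + r * r * (w \<bullet> w) = 1" if "norm (x + r *\<^sub>R w) = 1" for r
    using that by (simp add: norm_eq_1 inner_add_left inner_add_right inner_commute algebra_simps)
  note eqs = quadratic[OF assms(3)] quadratic[OF assms(4)] quadratic[OF assms(5)]
  have "(q - p) * (2 * (x \<bullet> w) + (q + p) * (w \<bullet> w)) = 0"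
    using eqs(1,2) by (simp add: algebra_simps)
  then have pq: "2 * (x \<bullet> w) + (q + p) * (w \<bullet> w) = 0"
    using assms(2) by simp
  have "(t - p) * (2 * (x \<bullet> w) + (t + p) * (w \<bullet> w)) = 0"
    using eqs(1,3) by (simp add: algebra_simps)
  moreover have "2 * (x \<bullet> w) + (t + p) * (w \<bullet> w) = (t - q) * (w \<bullet> w)"
    using pq by (simp add: algebra_simps)
  ultimately show ?thesis
    using assms(1) by simp
qed

lemma hilbert_ends_eq:
  fixes x y :: "'a::euclidean_space"
  assumes "x \<noteq> y" "\<alpha> > 0" "\<beta> > 0"
    and u: "norm (x + \<alpha> *\<^sub>R (x - y)) = 1" and v: "norm (y + \<beta> *\<^sub>R (y - x)) = 1"
  shows "hilbert_ends x y = (x + \<alpha> *\<^sub>R (x - y), y + \<beta> *\<^sub>R (y - x))"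
proof -
  define w where "w = y - x"
  define U where "U = x + \<alpha> *\<^sub>R (x - y)"
  define V where "V = y + \<beta> *\<^sub>R (y - x)"
  have "w \<noteq> 0" using assms(1) by (simp add: w_def)
  have U: "U = x + (- \<alpha>) *\<^sub>R w" and V: "V = x + (1 + \<beta>) *\<^sub>R w" and y: "y = x + w"
    by (simp_all add: U_def V_def w_def algebra_simps)
  have sphere: "norm (x + (- \<alpha>) *\<^sub>R w) = 1" "norm (x + (1 + \<beta>) *\<^sub>R w) = 1"
    using u v U V by (simp_all add: U_def V_def)
  have line: "affine hull {x, y} = range (\<lambda>t. x + t *\<^sub>R w)"
    by (auto simp: affine_hull_2_alt w_def)
  have on_line: "x + t *\<^sub>R w \<in> affine hull {x, y}" for t
    unfolding line by blast
  have ends: "affine hull {x, y} \<inter> sphere 0 1 = {U, V}"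
  proof
    show "affine hull {x, y} \<inter> sphere 0 1 \<subseteq> {U, V}"
      using norm_eq_1_on_line[OF \<open>w \<noteq> 0\<close> _ sphere] assms(2,3) by (fastforce simp: line U V)
    show "{U, V} \<subseteq> affine hull {x, y} \<inter> sphere 0 1"
      using sphere on_line[of "- \<alpha>"] on_line[of "1 + \<beta>"] by (simp add: U V)
  qed
  have dists: "dist U x = \<alpha> * norm w" "dist U y = (1 + \<alpha>) * norm w"
    "dist V x = (1 + \<beta>) * norm w" "dist V y = \<beta> * norm w"
  proof -
    have "U - y = (- (1 + \<alpha>)) *\<^sub>R w" "V - y = \<beta> *\<^sub>R w"
      by (simp_all add: U V y algebra_simps)
    then show "dist U x = \<alpha> * norm w" "dist U y = (1 + \<alpha>) * norm w"
      "dist V x = (1 + \<beta>) * norm w" "dist V y = \<beta> * norm w"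
      using assms(2,3) by (simp_all only: dist_norm norm_scaleR) (simp_all add: U V)
  qed
  have "norm w > 0" using \<open>w \<noteq> 0\<close> by simp
  then have order: "dist U x < dist U y" "\<not> dist V x < dist V y"
    by (simp_all add: dists)
  have "hilbert_ends x y = (U, V)"
    unfolding hilbert_ends_def ends
    by (rule the_equality) (use order in \<open>auto simp: doubleton_eq_iff\<close>)
  then show ?thesis by (simp add: U_def V_def)
qed

lemma hilbert_ball_eq_ln_add:
  fixes x y :: "'a::euclidean_space"
  assumes "x \<noteq> y" "\<alpha> > 0" "\<beta> > 0"
    and "norm (x + \<alpha> *\<^sub>R (x - y)) = 1" "norm (y + \<beta> *\<^sub>R (y - x)) = 1"
  shows "hilbert_ball x y = ln (1 + 1 / \<alpha>) + ln (1 + 1 / \<beta>)"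
proof -
  let ?u = "x + \<alpha> *\<^sub>R (x - y)" and ?v = "y + \<beta> *\<^sub>R (y - x)"
  define d where "d = norm (x - y)"
  have "d > 0" using assms(1) by (simp add: d_def)
  have "?u - y = (1 + \<alpha>) *\<^sub>R (x - y)" "x - ?v = (1 + \<beta>) *\<^sub>R (x - y)"
    "?u - x = \<alpha> *\<^sub>R (x - y)" "y - ?v = \<beta> *\<^sub>R (x - y)"
    by (simp_all add: algebra_simps)
  then have dists: "dist ?u y = (1 + \<alpha>) * d" "dist x ?v = (1 + \<beta>) * d"
    "dist ?u x = \<alpha> * d" "dist y ?v = \<beta> * d"
    using assms(2,3) by (simp_all only: dist_norm norm_scaleR d_def)
  have "hilbert_ball x y = ln (((1 + \<alpha>) * d * ((1 + \<beta>) * d)) / (\<alpha> * d * (\<beta> * d)))"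
    by (simp only: hilbert_ball_def hilbert_ends_eq[OF assms] assms(1) if_False Let_def case_prod_conv dists)
  also have "((1 + \<alpha>) * d * ((1 + \<beta>) * d)) / (\<alpha> * d * (\<beta> * d)) = (1 + 1 / \<alpha>) * (1 + 1 / \<beta>)"
    using assms(2,3) \<open>d > 0\<close> by (simp add: field_simps)
  also have "ln \<dots> = ln (1 + 1 / \<alpha>) + ln (1 + 1 / \<beta>)"
    using assms(2,3) by (intro ln_mult_pos) (simp_all add: add_pos_pos)
  finally show ?thesis .
qed

lemma exit_unit_ball:
  fixes x y :: "'a::euclidean_space"
  assumes "norm x < 1" "x \<noteq> y"
  obtains \<alpha> where "\<alpha> > 0" "norm (x + \<alpha> *\<^sub>R (x - y)) = 1"
proof -
  have "x \<in> interior (ball 0 1)" "x - y \<noteq> 0" using assms by auto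
  from ray_to_frontier[OF bounded_ball this] obtain \<alpha>
    where "0 < \<alpha>" "x + \<alpha> *\<^sub>R (x - y) \<in> frontier (ball 0 1)" by blast
  then show thesis using that by simp
qed

section \<open>Comparison with the distance ratio metric\<close>

text \<open>
  The point where a ray from \<open>x\<close> leaves the ball is at distance at least \<open>1 - |x|\<close> from \<open>x\<close>, the
  distance from \<open>x\<close> to the whole sphere.
\<close>

lemma exit_parameter_bound:
  fixes x y :: "'a::real_normed_vector"
  assumes "\<alpha> > 0" "norm (x + \<alpha> *\<^sub>R (x - y)) = 1"
  shows "1 - norm x \<le> \<alpha> * dist x y"
  using norm_triangle_ineq[of x "\<alpha> *\<^sub>R (x - y)"] assms by (simp add: dist_norm)

lemma ln_1_plus_inverse_le:
  fixes \<alpha> d m :: real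
  assumes "\<alpha> > 0" "d > 0" "m > 0" "m \<le> \<alpha> * d"
  shows "ln (1 + 1 / \<alpha>) \<le> ln (1 + d / m)"
    and "ln (1 + 1 / \<alpha>) = ln (1 + d / m) \<longleftrightarrow> \<alpha> * d = m"
proof -
  have "1 / \<alpha> \<le> d / m" using assms by (simp add: field_simps)
  then show "ln (1 + 1 / \<alpha>) \<le> ln (1 + d / m)"
    using assms by (simp add: add_pos_pos)
  have "ln (1 + 1 / \<alpha>) = ln (1 + d / m) \<longleftrightarrow> 1 / \<alpha> = d / m"
    using assms by (simp add: add_pos_pos)
  then show "ln (1 + 1 / \<alpha>) = ln (1 + d / m) \<longleftrightarrow> \<alpha> * d = m"
    using assms by (auto simp: field_simps)
qed

text \<open>
  Sharpness of both triangle inequalities determines the configuration: equality in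
  \<open>|x + \<alpha> (x - y)| \<le> |x| + \<alpha> d\<close> means \<open>|x| (x - y) = d x\<close>. Adding the corresponding identity with \<open>x\<close>
  and \<open>y\<close> exchanged gives \<open>d (x + y) = 0\<close> when \<open>|x| = |y|\<close>.
\<close>

lemma sharp_exit_parameters_iff:
  fixes x y :: "'a::real_inner"
  assumes "x \<noteq> y" "\<alpha> > 0" "\<beta> > 0"
    and u: "norm (x + \<alpha> *\<^sub>R (x - y)) = 1" and v: "norm (y + \<beta> *\<^sub>R (y - x)) = 1"
  shows "\<alpha> * dist x y = min (1 - norm x) (1 - norm y) \<and>
         \<beta> * dist x y = min (1 - norm x) (1 - norm y) \<longleftrightarrow> x = - y"
proof
  assume sharp: "\<alpha> * dist x y = min (1 - norm x) (1 - norm y) \<and>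
                 \<beta> * dist x y = min (1 - norm x) (1 - norm y)"
  have "1 - norm x \<le> \<alpha> * dist x y" "1 - norm y \<le> \<beta> * dist x y"
    using exit_parameter_bound[OF assms(2) u] exit_parameter_bound[OF assms(3) v]
    by (simp_all add: dist_commute)
  with sharp have norms: "norm x = norm y" "\<alpha> * dist x y = 1 - norm x" "\<beta> * dist x y = 1 - norm y"
    by (simp_all add: min_def split: if_splits)
  have colinear: "norm p *\<^sub>R (p - q) = dist p q *\<^sub>R p"
    if "r > 0" "norm (p + r *\<^sub>R (p - q)) = 1" "r * dist p q = 1 - norm p" for p q :: 'a and r
  proof -
    have "norm (p + r *\<^sub>R (p - q)) = norm p + norm (r *\<^sub>R (p - q))"
      using that by (simp add: dist_norm)
    then have "r *\<^sub>R (norm p *\<^sub>R (p - q)) = r *\<^sub>R (dist p q *\<^sub>R p)"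
      using \<open>r > 0\<close> unfolding norm_triangle_eq by (simp add: dist_norm mult.commute)
    then show ?thesis using \<open>r > 0\<close> unfolding scaleR_cancel_left by simp
  qed
  have "norm x *\<^sub>R (x - y) = dist x y *\<^sub>R x"
    by (rule colinear[OF assms(2) u norms(2)])
  moreover have "norm x *\<^sub>R (y - x) = dist x y *\<^sub>R y"
    using colinear[OF assms(3) v] norms by (simp add: dist_commute)
  moreover have "norm x *\<^sub>R (x - y) + norm x *\<^sub>R (y - x) = 0"
    by (simp add: algebra_simps)
  ultimately have "dist x y *\<^sub>R (x + y) = 0"
    by (simp add: scaleR_add_right)
  then show "x = - y"
    using assms(1) by (simp add: add_eq_0_iff2)
next
  assume "x = - y"
  then have "x + \<alpha> *\<^sub>R (x - y) = - ((1 + 2 * \<alpha>) *\<^sub>R y)" "y + \<beta> *\<^sub>R (y - x) = (1 + 2 * \<beta>) *\<^sub>R y"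
    by (simp_all add: algebra_simps scaleR_2[symmetric])
  then have "(1 + 2 * \<alpha>) * norm y = 1" "(1 + 2 * \<beta>) * norm y = 1"
    using u v assms(2,3) by (simp_all only: norm_minus_cancel norm_scaleR)
  moreover have "dist x y = 2 * norm y"
  proof -
    have "x - y = - (2 *\<^sub>R y)" using \<open>x = - y\<close> by (simp add: scaleR_2)
    then show ?thesis by (simp only: dist_norm norm_minus_cancel norm_scaleR)
  qed
  ultimately show "\<alpha> * dist x y = min (1 - norm x) (1 - norm y) \<and>
                   \<beta> * dist x y = min (1 - norm x) (1 - norm y)"
    using \<open>x = - y\<close> by (simp add: algebra_simps)
qed

lemma hilbert_ball_le_dist_ratio_ball:
  fixes x y :: "'a::euclidean_space"
  assumes "norm x < 1" "norm y < 1" "x \<noteq> y"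
  shows "hilbert_ball x y \<le> 2 * dist_ratio_ball x y"
    and "hilbert_ball x y = 2 * dist_ratio_ball x y \<longleftrightarrow> x = - y"
proof -
  obtain \<alpha> where \<alpha>: "\<alpha> > 0" "norm (x + \<alpha> *\<^sub>R (x - y)) = 1"
    using exit_unit_ball[of x y] assms by metis
  obtain \<beta> where \<beta>: "\<beta> > 0" "norm (y + \<beta> *\<^sub>R (y - x)) = 1"
    using exit_unit_ball[of y x] assms by metis
  define d where "d = dist x y"
  define m where "m = min (1 - norm x) (1 - norm y)"
  have "d > 0" "m > 0" using assms by (simp_all add: d_def m_def)
  have "m \<le> \<alpha> * d" "m \<le> \<beta> * d"
    using exit_parameter_bound[OF \<alpha>] exit_parameter_bound[OF \<beta>]
    by (simp_all add: d_def m_def dist_commute)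
  note \<alpha>_le = ln_1_plus_inverse_le[OF \<alpha>(1) \<open>d > 0\<close> \<open>m > 0\<close> this(1)]
    and \<beta>_le = ln_1_plus_inverse_le[OF \<beta>(1) \<open>d > 0\<close> \<open>m > 0\<close> this(2)]
  have h: "hilbert_ball x y = ln (1 + 1 / \<alpha>) + ln (1 + 1 / \<beta>)"
    by (rule hilbert_ball_eq_ln_add[OF assms(3) \<alpha>(1) \<beta>(1) \<alpha>(2) \<beta>(2)])
  have j: "dist_ratio_ball x y = ln (1 + d / m)"
    by (simp add: dist_ratio_ball_def d_def m_def)
  show "hilbert_ball x y \<le> 2 * dist_ratio_ball x y"
    using \<alpha>_le(1) \<beta>_le(1) by (simp add: h j)
  have "hilbert_ball x y = 2 * dist_ratio_ball x y \<longleftrightarrow> \<alpha> * d = m \<and> \<beta> * d = m"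
    using \<alpha>_le \<beta>_le unfolding h j by linarith
  also have "\<dots> \<longleftrightarrow> x = - y"
    unfolding d_def m_def by (rule sharp_exit_parameters_iff[OF assms(3) \<alpha>(1) \<beta>(1) \<alpha>(2) \<beta>(2)])
  finally show "hilbert_ball x y = 2 * dist_ratio_ball x y \<longleftrightarrow> x = - y" .
qed

section \<open>Unboundedness of the distance ratio metric\<close>

text \<open>
  The chord parallel to \<open>f\<close> with midpoint \<open>s e\<close>, where \<open>s\<^sup>2 = 1 - 4 k\<^sup>2\<close>, has length \<open>4 k\<close>, and
  \<open>s e \<plusminus> k f\<close> cut it in the ratio \<open>1 : 2 : 1\<close>; so both
  exit parameters are \<open>1/2\<close>. Both points have squared norm \<open>1 - 3 k\<^sup>2\<close>, hence
  distance at most \<open>3 k\<^sup>2\<close> to the sphere, while they are \<open>2 k\<close> apart.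
\<close>

lemma chord_quarter_points:
  fixes e f :: "'a::euclidean_space"
  assumes "norm e = 1" "norm f = 1" "e \<bullet> f = 0" and k: "0 < k" "2 * k \<le> 1"
  obtains x y :: 'a where "norm x < 1" "norm y < 1" "hilbert_ball x y = 2 * ln 3"
    "dist_ratio_ball x y \<ge> ln (1 + 2 / (3 * k))"
proof -
  define s where "s = sqrt (1 - 4 * k\<^sup>2)"
  define x where "x = s *\<^sub>R e - k *\<^sub>R f"
  define y where "y = s *\<^sub>R e + k *\<^sub>R f"
  have "(2 * k)\<^sup>2 \<le> 1" using k by (intro power_le_one) auto
  then have s: "s\<^sup>2 = 1 - 4 * k\<^sup>2" by (simp add: s_def power_mult_distrib)
  have norm_sq: "(norm (s *\<^sub>R e + r *\<^sub>R f))\<^sup>2 = 1 - 4 * k\<^sup>2 + r\<^sup>2" for r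
  proof -
    have "e \<bullet> e = 1" "f \<bullet> f = 1" using assms(1,2) by (simp_all add: norm_eq_1)
    then show ?thesis
      using assms(3) s unfolding power2_norm_eq_inner
      by (simp add: inner_add_left inner_add_right inner_commute power2_eq_square)
  qed
  have x: "x = s *\<^sub>R e + (- k) *\<^sub>R f" and diff: "x - y = (- 2 * k) *\<^sub>R f"
    and diff': "y - x = (2 * k) *\<^sub>R f"
    by (simp_all add: x_def y_def algebra_simps scaleR_2[symmetric])
  have xy_sq: "(norm x)\<^sup>2 = 1 - 3 * k\<^sup>2" "(norm y)\<^sup>2 = 1 - 3 * k\<^sup>2"
    using norm_sq[of k] norm_sq[of "- k"] by (simp_all add: x y_def)
  have lt: "norm x < 1" "norm y < 1"
    using xy_sq k by (auto intro!: power2_less_imp_less[of _ 1])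
  have "x \<noteq> y" using diff k assms(2) by auto
  have "x + (1 / 2) *\<^sub>R (x - y) = s *\<^sub>R e + (- 2 * k) *\<^sub>R f"
    by (simp add: diff) (simp add: x scaleR_2[symmetric] algebra_simps)
  moreover have "y + (1 / 2) *\<^sub>R (y - x) = s *\<^sub>R e + (2 * k) *\<^sub>R f"
    by (simp add: diff') (simp add: y_def scaleR_2[symmetric])
  ultimately have "(norm (x + (1 / 2) *\<^sub>R (x - y)))\<^sup>2 = 1" "(norm (y + (1 / 2) *\<^sub>R (y - x)))\<^sup>2 = 1"
    by (simp_all only: norm_sq) (simp_all add: power_mult_distrib)
  then have "norm (x + (1 / 2) *\<^sub>R (x - y)) = 1" "norm (y + (1 / 2) *\<^sub>R (y - x)) = 1"
    by (simp_all only: abs_square_eq_1 abs_norm_cancel)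
  then have h: "hilbert_ball x y = 2 * ln 3"
    using hilbert_ball_eq_ln_add[OF \<open>x \<noteq> y\<close>, of "1 / 2" "1 / 2"] by simp
  have "1 - norm x \<le> 3 * k\<^sup>2"
  proof -
    have "(norm x)\<^sup>2 \<le> norm x" using lt by (simp add: power2_eq_square mult_left_le)
    then show ?thesis using xy_sq by simp
  qed
  moreover have "norm x = norm y"
    using xy_sq by (metis norm_ge_zero power2_eq_iff_nonneg)
  moreover have "dist x y = 2 * k"
    using k assms(2) by (simp add: dist_norm diff)
  ultimately have "2 * k / (3 * k\<^sup>2) \<le> dist x y / min (1 - norm x) (1 - norm y)"
    using k lt by (simp add: frac_le)
  moreover have "2 * k / (3 * k\<^sup>2) = 2 / (3 * k)"
    using k by (simp add: power2_eq_square)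
  ultimately have "ln (1 + 2 / (3 * k)) \<le> dist_ratio_ball x y"
    unfolding dist_ratio_ball_def using k by (intro ln_mono) (simp_all add: add_pos_pos)
  with lt h show thesis by (rule that)
qed

lemma dist_ratio_ball_not_le_hilbert_ball:
  fixes c :: real
  assumes "DIM('a::euclidean_space) \<ge> 2"
  shows "\<exists>x \<in> ball (0::'a) 1. \<exists>y \<in> ball 0 1. \<not> dist_ratio_ball x y \<le> c * hilbert_ball x y"
proof -
  obtain e f :: 'a where "e \<in> Basis" "f \<in> Basis" "e \<noteq> f"
    using assms by (metis card_2_iff' ex_card subset_iff)
  then have ef: "norm e = 1" "norm f = 1" "e \<bullet> f = 0"
    by (simp_all add: inner_Basis)
  define M where "M = exp (c * (2 * ln 3))"
  have "M > 0" by (simp add: M_def)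
  \<comment> \<open>chosen so that \<open>2 / (3 * k) = 2 * (1 + M)\<close> exceeds \<open>M\<close>, while \<open>k < 1 / 3\<close>\<close>
  define k where "k = 1 / (3 * (1 + M))"
  have k: "0 < k" "2 * k \<le> 1" using \<open>M > 0\<close> by (simp_all add: k_def field_simps)
  obtain x y :: 'a where xy: "norm x < 1" "norm y < 1" "hilbert_ball x y = 2 * ln 3"
    and j: "dist_ratio_ball x y \<ge> ln (1 + 2 / (3 * k))"
    using chord_quarter_points[OF ef k] by blast
  have "c * hilbert_ball x y = ln M" by (simp add: M_def xy)
  also have "\<dots> < ln (1 + 2 / (3 * k))"
  proof -
    have "2 / (3 * k) = 2 * (1 + M)" using \<open>M > 0\<close> by (simp add: k_def)
    then show ?thesis using \<open>M > 0\<close> by simp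
  qed
  also note j
  finally have "\<not> dist_ratio_ball x y \<le> c * hilbert_ball x y" by simp
  with xy show ?thesis by (intro bexI[of _ x] bexI[of _ y]) auto
qed

theorem theorem4p1:
  assumes "CARD('n::finite) \<ge> 2"
  shows "(\<forall>x \<in> ball (0 :: real ^ 'n) 1. \<forall>y \<in> ball 0 1.
            hilbert_ball x y \<le> 2 * dist_ratio_ball x y) \<and>
         (\<forall>x \<in> ball (0 :: real ^ 'n) 1. \<forall>y \<in> ball 0 1. x \<noteq> y \<longrightarrow>
            (hilbert_ball x y = 2 * dist_ratio_ball x y \<longleftrightarrow> x = - y)) \<and>
         (\<forall>x \<in> ball (0 :: real ^ 'n) 1.
            hilbert_ball x x = 0 \<and> dist_ratio_ball x x = 0) \<and>
         \<not> (\<exists>c :: real. \<forall>x \<in> ball (0 :: real ^ 'n) 1. \<forall>y \<in> ball 0 1.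
            dist_ratio_ball x y \<le> c * hilbert_ball x y)"
proof (intro conjI ballI impI notI)
  fix x y :: "real ^ 'n"
  assume "x \<in> ball 0 1" "y \<in> ball 0 1"
  then show "hilbert_ball x y \<le> 2 * dist_ratio_ball x y"
    using hilbert_ball_le_dist_ratio_ball(1)[of x y]
    by (cases "x = y") (simp_all add: hilbert_ball_def dist_ratio_ball_def)
next
  fix x y :: "real ^ 'n"
  assume "x \<in> ball 0 1" "y \<in> ball 0 1" "x \<noteq> y"
  then show "hilbert_ball x y = 2 * dist_ratio_ball x y \<longleftrightarrow> x = - y"
    by (intro hilbert_ball_le_dist_ratio_ball(2)) simp_all
next
  fix x :: "real ^ 'n"
  show "hilbert_ball x x = 0" by (simp add: hilbert_ball_def)
  show "dist_ratio_ball x x = 0" by (simp add: dist_ratio_ball_def)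
next
  assume "\<exists>c :: real. \<forall>x \<in> ball (0 :: real ^ 'n) 1. \<forall>y \<in> ball 0 1.
            dist_ratio_ball x y \<le> c * hilbert_ball x y"
  moreover have "DIM(real ^ 'n) \<ge> 2" using assms by simp
  ultimately show False
    using dist_ratio_ball_not_le_hilbert_ball by blast
qed

end
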